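(* Let $p\ge1$ and $\rho\in(0,1)$. Let $\mathbf{\Delta}\subset\{\Delta\in\mathcal{L}(\ell_2^p,\ell_2^p)\mid\Delta(\ell_{2,\rho}^p)\subset\ell_{2,\rho}^p\}$ be some set of operators. Suppose that $\phi:\ell_f^{2p}\to\ell_e^{2p}$ is a linear operator such that $\tilde\phi=\rho_+\circ\phi\circ\rho_+$ is bounded on $\ell_2^{2p}$ and $$\left\langle\begin{bmatrix}y\\\Delta(y)\end{bmatrix},O_T\,\phi\,O_T\begin{bmatrix}y\\\Delta(y)\end{bmatrix}\right\rangle\ge0$$ for all $y\in\ell_2^p$, all $\Delta\in\mathbf{\Delta}$ and all $T\in\mathbb{N}$. Then $$\left\langle\begin{bmatrix}y\\\Delta_\rho(y)\end{bmatrix},\tilde\phi\begin{bmatrix}y\\\Delta_\rho(y)\end{bmatrix}\right\rangle\ge0$$ holds for all $y\in\ell_2^p$ and any $\Delta_\rho=\rho_-\circ\Delta\circ\rho_+$ with $\Delta\in\mathbf{\Delta}$.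
   Context: $\mathbb{N}=\{0,1,2,\dots\}$. $\ell_e^q$ is the space of all sequences $(q_k)_{k\in\mathbb{N}}$ in $\mathbb{R}^q$, $\ell_f^q$ the subspace of finitely supported sequences, $\ell_2^q$ the square-summable sequences with inner product $\langle u,y\rangle=\sum_ku_k^\top y_k$. $\mathcal{L}(\ell_2^p,\ell_2^p)$ is the set of (not necessarily linear) operators $\Delta:\ell_2^p\to\ell_2^p$ that are bounded, i.e. there is $\beta\ge0$ with $\|\Delta(y)\|_{\ell_2}\le\beta\|y\|_{\ell_2}$ for all $y$. $(\rho_+(y))_k=\rho^ky_k$, $(\rho_-(y))_k=\rho^{-k}y_k$. $\ell_{2,\rho}^p=\{y\in\ell_e^p:\rho_-(y)\in\ell_2^p\}\subset\ell_2^p$. $O_T$ is truncation: $O_T(y)=(y_0,\dots,y_T,0,0,\dots)$. "$\tilde\phi$ is bounded on $\ell_2^{2p}$" means that $\tilde\phi$, defined on $\ell_f^{2p}$, is bounded in the $\ell_2$-norm with values in $\ell_2^{2p}$; in the conclusion $\tilde\phi$ denotes its continuous extension to $\ell_2^{2p}$. *)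

theory Defs
  imports "HOL-Analysis.Analysis"
begin

text \<open>Sequences in \<open>\<real>\<^sup>q\<close> are functions \<open>nat \<Rightarrow> real ^ 'q\<close> with \<open>q = CARD('q) \<ge> 1\<close>; the space
  of all sequences is the whole type.\<close>

type_synonym 'q signal = "nat \<Rightarrow> real ^ 'q"

definition ellf :: "('q::finite) signal set" where
  "ellf = {u. finite {k. u k \<noteq> 0}}"

definition ell2 :: "('q::finite) signal set" where
  "ell2 = {u. summable (\<lambda>k. (norm (u k))\<^sup>2)}"

definition l2_inner :: "('q::finite) signal \<Rightarrow> 'q signal \<Rightarrow> real" where
  "l2_inner u y = (\<Sum>k. u k \<bullet> y k)"

definition l2_norm :: "('q::finite) signal \<Rightarrow> real" where
  "l2_norm u = sqrt (l2_inner u u)"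

definition rho_plus :: "real \<Rightarrow> ('q::finite) signal \<Rightarrow> 'q signal" where
  "rho_plus \<rho> y = (\<lambda>k. \<rho> ^ k *\<^sub>R y k)"

definition rho_minus :: "real \<Rightarrow> ('q::finite) signal \<Rightarrow> 'q signal" where
  "rho_minus \<rho> y = (\<lambda>k. inverse (\<rho> ^ k) *\<^sub>R y k)"

definition ell2_rho :: "real \<Rightarrow> ('q::finite) signal set" where
  "ell2_rho \<rho> = {y. rho_minus \<rho> y \<in> ell2}"

definition trunc :: "nat \<Rightarrow> ('q::finite) signal \<Rightarrow> 'q signal" where
  "trunc T y = (\<lambda>k. if k \<le> T then y k else 0)"

text \<open>Operators are functions on all sequences, of which only the restriction to the stated
  domain matters: here \<open>F : S \<rightarrow> \<ell>\<^sub>2\<close>, not necessarily linear.\<close>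

definition l2_bounded_on :: "('q::finite) signal set \<Rightarrow> ('q signal \<Rightarrow> 'q signal) \<Rightarrow> bool" where
  "l2_bounded_on S F \<longleftrightarrow> F ` S \<subseteq> ell2 \<and> (\<exists>\<beta>\<ge>0. \<forall>y\<in>S. l2_norm (F y) \<le> \<beta> * l2_norm y)"

definition bounded_operators :: "(('q::finite) signal \<Rightarrow> 'q signal) set" where
  "bounded_operators = {\<Delta>. l2_bounded_on ell2 \<Delta>}"

definition linear_on_ellf :: "(('q::finite) signal \<Rightarrow> 'q signal) \<Rightarrow> bool" where
  "linear_on_ellf \<phi> \<longleftrightarrow>
     (\<forall>u\<in>ellf. \<forall>v\<in>ellf. \<phi> (\<lambda>k. u k + v k) = (\<lambda>k. \<phi> u k + \<phi> v k)) \<and>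
     (\<forall>c. \<forall>u\<in>ellf. \<phi> (\<lambda>k. c *\<^sub>R u k) = (\<lambda>k. c *\<^sub>R \<phi> u k))"

definition l2_continuous :: "(('q::finite) signal \<Rightarrow> 'q signal) \<Rightarrow> bool" where
  "l2_continuous F \<longleftrightarrow> (\<forall>u\<in>ell2. \<forall>\<epsilon>>0. \<exists>\<delta>>0. \<forall>v\<in>ell2.
     l2_norm (\<lambda>k. v k - u k) < \<delta> \<longrightarrow> l2_norm (\<lambda>k. F v k - F u k) < \<epsilon>)"

text \<open>The continuous extension to \<open>\<ell>\<^sub>2\<close> of an operator given on \<open>\<ell>\<^sub>f\<close>. It exists when the operator
  is linear and bounded on \<open>\<ell>\<^sub>f\<close>. As \<open>\<ell>\<^sub>f\<close> is dense in \<open>\<ell>\<^sub>2\<close>, there is at most one;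
  \<open>extensional\<close> pins down the irrelevant values outside \<open>\<ell>\<^sub>2\<close>.\<close>

definition l2_extension :: "(('q::finite) signal \<Rightarrow> 'q signal) \<Rightarrow> ('q signal \<Rightarrow> 'q signal)" where
  "l2_extension \<psi> = (THE F. F \<in> extensional ell2 \<and> F ` ell2 \<subseteq> ell2 \<and> l2_continuous F \<and>
     (\<forall>u\<in>ellf. F u = \<psi> u))"

text \<open>\<open>stack y w\<close> is the sequence of block vectors with upper block \<open>y\<close> and lower block \<open>w\<close>;
  \<open>real ^ ('p + 'p)\<close> is \<open>\<real>\<^sup>2\<^sup>p\<close> with \<open>p = CARD('p)\<close>.\<close>

definition stack :: "('p::finite) signal \<Rightarrow> 'p signal \<Rightarrow> ('p + 'p) signal" where
  "stack y w = (\<lambda>k. \<chi> i. case i of Inl a \<Rightarrow> y k $ a | Inr b \<Rightarrow> w k $ b)"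

end

theory Submission
  imports Defs
begin

text \<open>Put \<open>\<psi> = \<rho>\<^sub>+ \<circ> \<phi> \<circ> \<rho>\<^sub>+\<close> and let \<open>z\<close> be the stacked signal of \<open>y\<close> and \<open>\<Delta>\<^sub>\<rho> y\<close>, so that
  \<open>\<rho>\<^sub>+ z\<close> is the stacked signal of \<open>\<rho>\<^sub>+ y\<close> and \<open>\<Delta> (\<rho>\<^sub>+ y)\<close>. Since \<open>\<rho>\<^sub>+\<close> is symmetric and commutes
  with truncation, the hypothesis at \<open>\<rho>\<^sub>+ y\<close> says that the inner product of \<open>O\<^sub>T z\<close> with
  \<open>\<psi> (O\<^sub>T z)\<close> is nonnegative. Because \<open>O\<^sub>T z\<close> converges to \<open>z\<close>, these inner products converge to
  the one of \<open>z\<close> with the value of the continuous extension of \<open>\<psi>\<close> at \<open>z\<close>.\<close>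

section \<open>Norm and inner product on \<open>ell2\<close> through finite sections\<close>

lemma l2_norm_eq: "l2_norm u = sqrt (\<Sum>k. (norm (u k))\<^sup>2)"
  by (simp add: l2_norm_def l2_inner_def power2_norm_eq_inner)

lemma L2_set_le_l2_norm:
  assumes "u \<in> ell2"
  shows "L2_set (\<lambda>k. norm (u k)) {..<n} \<le> l2_norm u"
  using assms unfolding L2_set_def l2_norm_eq ell2_def
  by (auto intro!: real_sqrt_le_mono sum_le_suminf)

lemma l2_norm_nonneg: "u \<in> ell2 \<Longrightarrow> 0 \<le> l2_norm u"
  using L2_set_le_l2_norm[of u 0] by simp

text \<open>Converse of \<open>L2_set_le_l2_norm\<close>: partial sums of nonnegative terms with a
  common bound converge. Together the two carry inequalities for \<open>L2_set\<close> over to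
  \<open>ell2\<close>, each time giving membership along with the norm estimate.\<close>

lemma ell2_L2_set_bounded:
  assumes "\<And>n. L2_set (\<lambda>k. norm (u k)) {..<n} \<le> c"
  shows "u \<in> ell2" and "l2_norm u \<le> c"
proof -
  have c: "0 \<le> c" using assms[of 0] by simp
  have le: "(\<Sum>k<n. (norm (u k))\<^sup>2) \<le> c\<^sup>2" for n
    using assms[of n] by (simp add: L2_set_def sqrt_le_D)
  then have s: "summable (\<lambda>k. (norm (u k))\<^sup>2)"
    by (intro summableI_nonneg_bounded) auto
  then show "u \<in> ell2" by (simp add: ell2_def)
  have "(\<Sum>k. (norm (u k))\<^sup>2) \<le> c\<^sup>2"
    using s le by (rule suminf_le_const)
  then show "l2_norm u \<le> c"
    unfolding l2_norm_eq using c by (rule real_le_lsqrt[rotated])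
qed

lemma
  assumes "u \<in> ell2" and "v \<in> ell2"
  shows ell2_add: "(\<lambda>k. u k + v k) \<in> ell2"
    and l2_norm_triangle: "l2_norm (\<lambda>k. u k + v k) \<le> l2_norm u + l2_norm v"
proof -
  have "L2_set (\<lambda>k. norm (u k + v k)) {..<n} \<le> l2_norm u + l2_norm v" for n
  proof -
    have "L2_set (\<lambda>k. norm (u k + v k)) {..<n} \<le> L2_set (\<lambda>k. norm (u k) + norm (v k)) {..<n}"
      by (intro L2_set_mono norm_triangle_ineq norm_ge_zero)
    also have "\<dots> \<le> L2_set (\<lambda>k. norm (u k)) {..<n} + L2_set (\<lambda>k. norm (v k)) {..<n}"
      by (rule L2_set_triangle_ineq)
    also have "\<dots> \<le> l2_norm u + l2_norm v"
      using assms by (intro add_mono L2_set_le_l2_norm)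
    finally show ?thesis .
  qed
  then show "(\<lambda>k. u k + v k) \<in> ell2" "l2_norm (\<lambda>k. u k + v k) \<le> l2_norm u + l2_norm v"
    by (rule ell2_L2_set_bounded)+
qed

lemma ell2_norm_mono:
  assumes "u \<in> ell2" and "\<And>k. norm (v k) \<le> norm (u k)"
  shows "v \<in> ell2" and "l2_norm v \<le> l2_norm u"
proof -
  have "L2_set (\<lambda>k. norm (v k)) {..<n} \<le> l2_norm u" for n
    using L2_set_mono[of "{..<n}" "\<lambda>k. norm (v k)" "\<lambda>k. norm (u k)"]
      L2_set_le_l2_norm[OF assms(1), of n] assms(2) by force
  then show "v \<in> ell2" "l2_norm v \<le> l2_norm u"
    by (rule ell2_L2_set_bounded)+
qed

lemma ell2_uminus: "u \<in> ell2 \<Longrightarrow> (\<lambda>k. - u k) \<in> ell2"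
  by (rule ell2_norm_mono) auto

lemma ell2_diff:
  assumes "u \<in> ell2" and "v \<in> ell2"
  shows "(\<lambda>k. u k - v k) \<in> ell2"
  using ell2_add[OF assms(1) ell2_uminus[OF assms(2)]] by simp

lemma l2_norm_minus_commute: "l2_norm (\<lambda>k. u k - v k) = l2_norm (\<lambda>k. v k - u k)"
  by (simp add: l2_norm_eq norm_minus_commute)

lemma norm_le_l2_norm:
  assumes "u \<in> ell2"
  shows "norm (u k) \<le> l2_norm u"
proof -
  have "norm (u k) \<le> L2_set (\<lambda>k. norm (u k)) {..<Suc k}"
    by (rule member_le_L2_set) auto
  also have "\<dots> \<le> l2_norm u" by (rule L2_set_le_l2_norm[OF assms])
  finally show ?thesis .
qed

lemma
  assumes "u \<in> ell2" and "v \<in> ell2"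
  shows l2_inner_summable: "summable (\<lambda>k. u k \<bullet> v k)"
    and l2_Cauchy_Schwarz: "\<bar>l2_inner u v\<bar> \<le> l2_norm u * l2_norm v"
proof -
  \<comment> \<open>The absolute values stand inside the sum so that this single bound yields both
    absolute summability and the estimate of the series.\<close>
  have le: "(\<Sum>k<n. \<bar>u k \<bullet> v k\<bar>) \<le> l2_norm u * l2_norm v" for n
  proof -
    have "(\<Sum>k<n. \<bar>u k \<bullet> v k\<bar>) \<le> (\<Sum>k<n. \<bar>norm (u k)\<bar> * \<bar>norm (v k)\<bar>)"
      by (intro sum_mono) (simp add: Cauchy_Schwarz_ineq2)
    also have "\<dots> \<le> L2_set (\<lambda>k. norm (u k)) {..<n} * L2_set (\<lambda>k. norm (v k)) {..<n}"
      by (rule L2_set_mult_ineq)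
    also have "\<dots> \<le> l2_norm u * l2_norm v"
      using assms by (intro mult_mono L2_set_le_l2_norm l2_norm_nonneg L2_set_nonneg)
    finally show ?thesis .
  qed
  then have s: "summable (\<lambda>k. \<bar>u k \<bullet> v k\<bar>)"
    by (intro summableI_nonneg_bounded) auto
  then show "summable (\<lambda>k. u k \<bullet> v k)" by (rule summable_rabs_cancel)
  have "\<bar>l2_inner u v\<bar> \<le> (\<Sum>k. \<bar>u k \<bullet> v k\<bar>)"
    unfolding l2_inner_def by (rule summable_rabs[OF s])
  also have "\<dots> \<le> l2_norm u * l2_norm v"
    using s le by (rule suminf_le_const)
  finally show "\<bar>l2_inner u v\<bar> \<le> l2_norm u * l2_norm v" .
qed

section \<open>Truncation and limits in \<open>ell2\<close>\<close>

lemma trunc_ellf: "trunc T u \<in> ellf"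
  unfolding ellf_def mem_Collect_eq
  by (rule finite_subset[of _ "{..T}"]) (auto simp: trunc_def split: if_splits)

lemma trunc_ell2: "u \<in> ell2 \<Longrightarrow> trunc T u \<in> ell2"
  by (rule ell2_norm_mono) (auto simp: trunc_def)

lemma l2_norm_trunc_le: "u \<in> ell2 \<Longrightarrow> l2_norm (trunc T u) \<le> l2_norm u"
  by (rule ell2_norm_mono) (auto simp: trunc_def)

lemma trunc_tendsto:
  assumes "u \<in> ell2"
  shows "(\<lambda>T. l2_norm (\<lambda>k. trunc T u k - u k)) \<longlonglongrightarrow> 0"
proof -
  let ?f = "\<lambda>k. (norm (u k))\<^sup>2"
  have s: "summable ?f" using assms by (simp add: ell2_def)
  \<comment> \<open>\<open>trunc T\<close> keeps the \<open>T + 1\<close> entries with index at most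
    \<open>T\<close>, so the squared error is the tail starting at \<open>Suc T\<close>.\<close>
  have eq: "l2_norm (\<lambda>k. trunc T u k - u k) = sqrt (\<Sum>k. ?f (k + Suc T))" for T
  proof -
    have d: "(\<lambda>k. trunc T u k - u k) \<in> ell2"
      by (intro ell2_diff trunc_ell2 assms)
    then have "(\<Sum>k. (norm (trunc T u k - u k))\<^sup>2) = (\<Sum>k. ?f (k + Suc T))"
      using suminf_split_initial_segment[of "\<lambda>k. (norm (trunc T u k - u k))\<^sup>2" "Suc T"]
      by (simp add: ell2_def trunc_def)
    then show ?thesis by (simp add: l2_norm_eq)
  qed
  have "(\<lambda>T. \<Sum>k. ?f (k + Suc T)) \<longlonglongrightarrow> 0"
    using LIMSEQ_Suc[OF suminf_exist_split2[OF s]] .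
  then show ?thesis unfolding eq using tendsto_real_sqrt by fastforce
qed

lemma trunc_eventually_eq:
  assumes "u \<in> ellf"
  shows "\<forall>\<^sub>F T in sequentially. trunc T u = u"
proof -
  obtain N where "\<forall>k\<in>{k. u k \<noteq> 0}. k \<le> N"
    using assms finite_nat_set_iff_bounded_le by (auto simp: ellf_def)
  then have "\<forall>T\<ge>N. trunc T u = u"
    by (fastforce simp: trunc_def fun_eq_iff)
  then show ?thesis by (auto simp: eventually_sequentially)
qed

text \<open>Closed balls of \<open>ell2\<close> are closed under coordinatewise convergence: the
  norm of a finite section depends continuously on finitely many coordinates, so the bound
  \<open>c\<close> passes to each section of the limit.\<close>

lemma l2_pointwise_limit:
  assumes lim: "\<And>k. (\<lambda>n. X n k) \<longlonglongrightarrow> L k"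
    and X: "\<forall>\<^sub>F n in sequentially. X n \<in> ell2 \<and> l2_norm (X n) \<le> c"
  shows "L \<in> ell2" and "l2_norm L \<le> c"
proof -
  have "L2_set (\<lambda>k. norm (L k)) {..<m} \<le> c" for m
  proof (rule tendsto_upperbound)
    show "(\<lambda>n. L2_set (\<lambda>k. norm (X n k)) {..<m}) \<longlonglongrightarrow> L2_set (\<lambda>k. norm (L k)) {..<m}"
      unfolding L2_set_def by (intro tendsto_intros lim)
    show "\<forall>\<^sub>F n in sequentially. L2_set (\<lambda>k. norm (X n k)) {..<m} \<le> c"
      using X by eventually_elim (rule order_trans[OF L2_set_le_l2_norm], auto)
  qed simp
  then show "L \<in> ell2" "l2_norm L \<le> c"
    by (rule ell2_L2_set_bounded)+
qed

text \<open>Each coordinate is dominated by the norm, so norm convergence forces coordinatewise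
  convergence, where limits are unique.\<close>

lemma l2_norm_limit_unique:
  assumes "u \<in> ell2" and "v \<in> ell2" and "\<And>n. X n \<in> ell2"
    and u: "(\<lambda>n. l2_norm (\<lambda>k. X n k - u k)) \<longlonglongrightarrow> 0"
    and v: "(\<lambda>n. l2_norm (\<lambda>k. X n k - v k)) \<longlonglongrightarrow> 0"
  shows "u = v"
proof
  fix k
  have "(\<lambda>n. X n k) \<longlonglongrightarrow> w k"
    if "w \<in> ell2" "(\<lambda>n. l2_norm (\<lambda>k. X n k - w k)) \<longlonglongrightarrow> 0" for w
  proof (rule LIM_zero_cancel, rule Lim_null_comparison[OF _ that(2)])
    show "\<forall>\<^sub>F n in sequentially. norm (X n k - w k) \<le> l2_norm (\<lambda>k. X n k - w k)"
      using norm_le_l2_norm[OF ell2_diff[OF assms(3) that(1)]] by auto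
  qed
  then show "u k = v k" using assms LIMSEQ_unique by blast
qed

lemma l2_continuous_trunc:
  assumes "l2_continuous F" and "u \<in> ell2" and F: "F ` ell2 \<subseteq> ell2"
  shows "(\<lambda>T. l2_norm (\<lambda>k. F (trunc T u) k - F u k)) \<longlonglongrightarrow> 0"
proof (rule LIMSEQ_I)
  fix \<epsilon> :: real
  assume "0 < \<epsilon>"
  then obtain \<delta> where \<delta>: "\<delta> > 0" "\<And>v. v \<in> ell2 \<Longrightarrow> l2_norm (\<lambda>k. v k - u k) < \<delta> \<Longrightarrow>
      l2_norm (\<lambda>k. F v k - F u k) < \<epsilon>"
    using assms(1,2) unfolding l2_continuous_def by metis
  obtain N where N: "\<And>T. T \<ge> N \<Longrightarrow> \<bar>l2_norm (\<lambda>k. trunc T u k - u k)\<bar> < \<delta>"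
    using LIMSEQ_D[OF trunc_tendsto[OF assms(2)] \<delta>(1)] by auto
  have "norm (l2_norm (\<lambda>k. F (trunc T u) k - F u k) - 0) < \<epsilon>" if "T \<ge> N" for T
  proof -
    have "l2_norm (\<lambda>k. F (trunc T u) k - F u k) < \<epsilon>"
      using \<delta>(2)[of "trunc T u"] N[OF that] trunc_ell2[OF assms(2)] by auto
    \<comment> \<open>The value of \<open>l2_norm\<close> is unspecified for sequences that are not
      square-summable, so its sign is known only because \<open>F\<close> maps \<open>ell2\<close>
      into itself.\<close>
    moreover have "0 \<le> l2_norm (\<lambda>k. F (trunc T u) k - F u k)"
      using F assms(2) trunc_ell2[OF assms(2)] by (intro l2_norm_nonneg ell2_diff) auto
    ultimately show ?thesis by simp
  qed
  then show "\<exists>N. \<forall>T\<ge>N. norm (l2_norm (\<lambda>k. F (trunc T u) k - F u k) - 0) < \<epsilon>" by blast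
qed

section \<open>The continuous extension from \<open>ellf\<close> to \<open>ell2\<close>\<close>

lemma linear_on_ellf_diff:
  assumes "linear_on_ellf \<psi>" and u: "u \<in> ellf" and v: "v \<in> ellf"
  shows "\<psi> (\<lambda>k. u k - v k) = (\<lambda>k. \<psi> u k - \<psi> v k)"
proof -
  have add: "\<And>w. w \<in> ellf \<Longrightarrow> \<psi> (\<lambda>k. u k + w k) = (\<lambda>k. \<psi> u k + \<psi> w k)"
    and scale: "\<And>c. \<psi> (\<lambda>k. c *\<^sub>R v k) = (\<lambda>k. c *\<^sub>R \<psi> v k)"
    using assms unfolding linear_on_ellf_def by simp_all
  have "(\<lambda>k. (-1) *\<^sub>R v k) \<in> ellf" using v by (simp add: ellf_def)
  from add[OF this] show ?thesis unfolding scale by simp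
qed

text \<open>The extension at \<open>u\<close> is the coordinatewise limit of
  \<open>\<psi> (trunc T u)\<close>. This uses only completeness of the finite-dimensional
  coordinate space; \<open>l2_pointwise_limit\<close> then supplies square-summability and the
  Lipschitz bound of the limit.\<close>

lemma l2_extension_exists:
  assumes lin: "linear_on_ellf \<psi>" and bdd: "l2_bounded_on ellf \<psi>"
  obtains F where "F \<in> extensional ell2" and "F ` ell2 \<subseteq> ell2" and "l2_continuous F"
    and "\<forall>u\<in>ellf. F u = \<psi> u"
proof -
  obtain \<beta> where \<beta>: "\<beta> \<ge> 0" "\<And>u. u \<in> ellf \<Longrightarrow> l2_norm (\<psi> u) \<le> \<beta> * l2_norm u"
    and \<psi>: "\<And>u. u \<in> ellf \<Longrightarrow> \<psi> u \<in> ell2"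
    using bdd unfolding l2_bounded_on_def by auto
  \<comment> \<open>Two indices and two signals are allowed because the estimate serves twice: with
    \<open>u = v\<close> for the Cauchy property, and with \<open>T = S\<close> for the Lipschitz
    bound.\<close>
  have diff: "(\<lambda>k. \<psi> (trunc T u) k - \<psi> (trunc S v) k) \<in> ell2 \<and>
      l2_norm (\<lambda>k. \<psi> (trunc T u) k - \<psi> (trunc S v) k)
        \<le> \<beta> * l2_norm (\<lambda>k. trunc T u k - trunc S v k)" for T S u v
  proof -
    have "(\<lambda>k. trunc T u k - trunc S v k) \<in> ellf"
      unfolding ellf_def mem_Collect_eq
      by (rule finite_subset[of _ "{..max T S}"]) (auto simp: trunc_def split: if_splits)
    then show ?thesis
      using \<psi> \<beta>(2) by (simp flip: linear_on_ellf_diff[OF lin trunc_ellf trunc_ellf])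
  qed
  have "convergent (\<lambda>T. \<psi> (trunc T u) k)" if u: "u \<in> ell2" for u k
    unfolding Cauchy_convergent_iff[symmetric]
  proof (rule metric_CauchyI)
    fix \<epsilon> :: real
    assume "\<epsilon> > 0"
    \<comment> \<open>Keeping the factor \<open>\<beta>\<close> inside the limit avoids a division
      by \<open>\<beta>\<close>, which may be zero.\<close>
    have "(\<lambda>T. \<beta> * l2_norm (\<lambda>k. trunc T u k - u k)) \<longlonglongrightarrow> 0"
      using tendsto_mult_right_zero[OF trunc_tendsto[OF u]] .
    from LIMSEQ_D[OF this, of "\<epsilon> / 2"] \<open>\<epsilon> > 0\<close> obtain N
      where N: "\<And>T. T \<ge> N \<Longrightarrow> \<beta> * l2_norm (\<lambda>k. trunc T u k - u k) < \<epsilon> / 2" by fastforce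
    have "dist (\<psi> (trunc T u) k) (\<psi> (trunc S u) k) < \<epsilon>" if "T \<ge> N" "S \<ge> N" for T S
    proof -
      have d: "(\<lambda>k. trunc T u k - u k) \<in> ell2" "(\<lambda>k. u k - trunc S u k) \<in> ell2"
        by (intro ell2_diff trunc_ell2 u)+
      have "dist (\<psi> (trunc T u) k) (\<psi> (trunc S u) k)
          \<le> l2_norm (\<lambda>k. \<psi> (trunc T u) k - \<psi> (trunc S u) k)"
        using norm_le_l2_norm[of "\<lambda>k. \<psi> (trunc T u) k - \<psi> (trunc S u) k" k] diff[of T u S u]
        by (simp add: dist_norm)
      also have "\<dots> \<le> \<beta> * l2_norm (\<lambda>k. trunc T u k - trunc S u k)"
        using diff by blast
      also have "\<dots> \<le> \<beta> * (l2_norm (\<lambda>k. trunc T u k - u k) + l2_norm (\<lambda>k. u k - trunc S u k))"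
        using l2_norm_triangle[OF d] \<beta>(1) by (simp add: mult_left_mono)
      also have "\<dots> < \<epsilon>"
        using N[OF that(1)] N[OF that(2)]
        by (simp add: distrib_left l2_norm_minus_commute[of u])
      finally show ?thesis .
    qed
    then show "\<exists>M. \<forall>m\<ge>M. \<forall>n\<ge>M. dist (\<psi> (trunc m u) k) (\<psi> (trunc n u) k) < \<epsilon>" by blast
  qed
  then obtain G where G: "\<And>u k. u \<in> ell2 \<Longrightarrow> (\<lambda>T. \<psi> (trunc T u) k) \<longlonglongrightarrow> G u k"
    unfolding convergent_def by metis
  have G_ell2: "G u \<in> ell2" if "u \<in> ell2" for u
  proof (rule l2_pointwise_limit(1)[OF G[OF that]])
    have "l2_norm (\<psi> (trunc T u)) \<le> \<beta> * l2_norm u" for T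
      using \<beta>(2)[OF trunc_ellf, of T u] mult_left_mono[OF l2_norm_trunc_le[OF that, of T] \<beta>(1)]
      by linarith
    then show "\<forall>\<^sub>F T in sequentially. \<psi> (trunc T u) \<in> ell2 \<and>
        l2_norm (\<psi> (trunc T u)) \<le> \<beta> * l2_norm u"
      using \<psi>[OF trunc_ellf] by simp
  qed
  have G_lip: "l2_norm (\<lambda>k. G v k - G u k) \<le> \<beta> * l2_norm (\<lambda>k. v k - u k)"
    if "u \<in> ell2" "v \<in> ell2" for u v
  proof (rule l2_pointwise_limit(2))
    show "(\<lambda>T. \<psi> (trunc T v) k - \<psi> (trunc T u) k) \<longlonglongrightarrow> G v k - G u k" for k
      by (intro tendsto_diff G that)
    have "l2_norm (\<lambda>k. \<psi> (trunc T v) k - \<psi> (trunc T u) k) \<le> \<beta> * l2_norm (\<lambda>k. v k - u k)" for T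
    proof -
      have "(\<lambda>k. trunc T v k - trunc T u k) = trunc T (\<lambda>k. v k - u k)"
        by (auto simp: trunc_def)
      then have "l2_norm (\<lambda>k. trunc T v k - trunc T u k) \<le> l2_norm (\<lambda>k. v k - u k)"
        using l2_norm_trunc_le[OF ell2_diff[OF that(2,1)], of T] by simp
      with diff[of T v T u] show ?thesis
        using mult_left_mono[OF _ \<beta>(1)] order_trans by blast
    qed
    then show "\<forall>\<^sub>F T in sequentially. (\<lambda>k. \<psi> (trunc T v) k - \<psi> (trunc T u) k) \<in> ell2 \<and>
        l2_norm (\<lambda>k. \<psi> (trunc T v) k - \<psi> (trunc T u) k) \<le> \<beta> * l2_norm (\<lambda>k. v k - u k)"
      using diff by simp
  qed
  have ellf_ell2: "u \<in> ell2" if u: "u \<in> ellf" for u :: "'a signal"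
    unfolding ell2_def mem_Collect_eq
    by (rule summable_finite[of "{k. u k \<noteq> 0}"]) (use u in \<open>auto simp: ellf_def\<close>)
  show ?thesis
  proof
    let ?F = "restrict G ell2"
    show "?F \<in> extensional ell2" by simp
    show "?F ` ell2 \<subseteq> ell2" using G_ell2 by auto
    show "l2_continuous ?F"
      unfolding l2_continuous_def
    proof (intro ballI allI impI)
      fix u :: "'a signal" and \<epsilon> :: real
      assume u: "u \<in> ell2" and \<epsilon>: "\<epsilon> > 0"
      \<comment> \<open>The Lipschitz constant is enlarged to \<open>\<beta> + 1\<close> so that the
        radius is defined even for \<open>\<beta> = 0\<close>.\<close>
      have "l2_norm (\<lambda>k. ?F v k - ?F u k) < \<epsilon>"
        if "v \<in> ell2" "l2_norm (\<lambda>k. v k - u k) < \<epsilon> / (\<beta> + 1)" for v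
      proof -
        have "l2_norm (\<lambda>k. G v k - G u k) \<le> (\<beta> + 1) * l2_norm (\<lambda>k. v k - u k)"
          using G_lip[OF u that(1)] l2_norm_nonneg[OF ell2_diff[OF that(1) u]]
          by (simp add: distrib_right)
        also have "\<dots> < \<epsilon>"
          using that(2) \<beta>(1) by (simp add: field_simps)
        finally show ?thesis using u that(1) by simp
      qed
      moreover have "\<epsilon> / (\<beta> + 1) > 0" using \<epsilon> \<beta>(1) by simp
      ultimately show "\<exists>\<delta>>0. \<forall>v\<in>ell2. l2_norm (\<lambda>k. v k - u k) < \<delta> \<longrightarrow>
          l2_norm (\<lambda>k. ?F v k - ?F u k) < \<epsilon>" by blast
    qed
    show "\<forall>u\<in>ellf. ?F u = \<psi> u"
    proof
      fix u :: "'a signal"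
      assume u: "u \<in> ellf"
      \<comment> \<open>Truncations of a finitely supported signal are eventually the signal itself,
        so the sequence defining \<open>G u k\<close> is eventually constant.\<close>
      have "G u k = \<psi> u k" for k
      proof (rule LIMSEQ_unique[OF G[OF ellf_ell2[OF u]] tendsto_eventually])
        show "\<forall>\<^sub>F T in sequentially. \<psi> (trunc T u) k = \<psi> u k"
          using trunc_eventually_eq[OF u] by eventually_elim simp
      qed
      then show "?F u = \<psi> u" using ellf_ell2[OF u] by auto
    qed
  qed
qed

text \<open>Justifies the definite description: any two candidates at \<open>u\<close> are limits in
  norm of the same sequence \<open>\<psi> (trunc T u)\<close>, hence agree on \<open>ell2\<close>,
  and outside \<open>ell2\<close> they agree by extensionality.\<close>

lemma l2_extension:
  assumes "linear_on_ellf \<psi>" and "l2_bounded_on ellf \<psi>"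
  shows "l2_extension \<psi> ` ell2 \<subseteq> ell2" and "l2_continuous (l2_extension \<psi>)"
    and "\<And>u. u \<in> ellf \<Longrightarrow> l2_extension \<psi> u = \<psi> u"
proof -
  let ?P = "\<lambda>F. F \<in> extensional ell2 \<and> F ` ell2 \<subseteq> ell2 \<and> l2_continuous F \<and> (\<forall>u\<in>ellf. F u = \<psi> u)"
  obtain F where F: "?P F" using l2_extension_exists[OF assms] by metis
  have "F' = F" if F': "?P F'" for F'
  proof (rule extensionalityI)
    show "F' \<in> extensional ell2" "F \<in> extensional ell2" using F F' by auto
    fix u :: "'a signal"
    assume u: "u \<in> ell2"
    have "(\<lambda>T. l2_norm (\<lambda>k. \<psi> (trunc T u) k - F' u k)) \<longlonglongrightarrow> 0"
      using l2_continuous_trunc[of F' u] F' u by (simp add: trunc_ellf)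
    moreover have "(\<lambda>T. l2_norm (\<lambda>k. \<psi> (trunc T u) k - F u k)) \<longlonglongrightarrow> 0"
      using l2_continuous_trunc[of F u] F u by (simp add: trunc_ellf)
    moreover have "F' u \<in> ell2" "F u \<in> ell2" using F F' u by auto
    moreover have "\<psi> (trunc T u) \<in> ell2" for T
      using assms(2) trunc_ellf unfolding l2_bounded_on_def by blast
    ultimately show "F' u = F u" by (rule l2_norm_limit_unique[rotated 3])
  qed
  with F have "?P (l2_extension \<psi>)"
    unfolding l2_extension_def by (rule theI)
  then show "l2_extension \<psi> ` ell2 \<subseteq> ell2" "l2_continuous (l2_extension \<psi>)"
    "\<And>u. u \<in> ellf \<Longrightarrow> l2_extension \<psi> u = \<psi> u" by auto
qed

lemma l2_quadratic_form_tendsto: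
  assumes "linear_on_ellf \<psi>" and "l2_bounded_on ellf \<psi>" and u: "u \<in> ell2"
  shows "(\<lambda>T. l2_inner (trunc T u) (\<psi> (trunc T u))) \<longlonglongrightarrow> l2_inner u (l2_extension \<psi> u)"
proof -
  define F where "F = l2_extension \<psi>"
  note F = l2_extension[OF assms(1,2), folded F_def]
  have Fu: "F u \<in> ell2" using F(1) u by auto
  have \<psi>: "\<psi> (trunc T u) \<in> ell2" for T
    using assms(2) trunc_ellf unfolding l2_bounded_on_def by blast
  \<comment> \<open>The bilinear difference is split as
    \<open><a, b> - <u, v> = <a, b - v> + <a - u, v>\<close>. By Cauchy-Schwarz each term is at most
    a constant times an error that tends to zero; \<open>l2_norm_trunc_le\<close> makes the first
    constant independent of \<open>T\<close>.\<close>
  have bound: "norm (l2_inner (trunc T u) (\<psi> (trunc T u)) - l2_inner u (F u))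
      \<le> l2_norm u * l2_norm (\<lambda>k. \<psi> (trunc T u) k - F u k) +
        l2_norm (\<lambda>k. trunc T u k - u k) * l2_norm (F u)" for T
  proof -
    have d: "(\<lambda>k. \<psi> (trunc T u) k - F u k) \<in> ell2" "(\<lambda>k. trunc T u k - u k) \<in> ell2"
      by (intro ell2_diff \<psi> Fu trunc_ell2 u)+
    note t = trunc_ell2[OF u, of T]
    have "l2_inner (trunc T u) (\<psi> (trunc T u)) - l2_inner u (F u) =
        (\<Sum>k. trunc T u k \<bullet> \<psi> (trunc T u) k - u k \<bullet> F u k)"
      unfolding l2_inner_def by (intro suminf_diff l2_inner_summable t \<psi> u Fu)
    also have "\<dots> = (\<Sum>k. trunc T u k \<bullet> (\<psi> (trunc T u) k - F u k) + (trunc T u k - u k) \<bullet> F u k)"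
      by (simp add: inner_diff_left inner_diff_right)
    also have "\<dots> = l2_inner (trunc T u) (\<lambda>k. \<psi> (trunc T u) k - F u k) +
        l2_inner (\<lambda>k. trunc T u k - u k) (F u)"
      unfolding l2_inner_def
      by (intro suminf_add[symmetric] l2_inner_summable[OF t d(1)] l2_inner_summable[OF d(2) Fu])
    finally have "l2_inner (trunc T u) (\<psi> (trunc T u)) - l2_inner u (F u) = \<dots>" .
    moreover have "\<bar>l2_inner (trunc T u) (\<lambda>k. \<psi> (trunc T u) k - F u k)\<bar>
        \<le> l2_norm u * l2_norm (\<lambda>k. \<psi> (trunc T u) k - F u k)"
      using l2_Cauchy_Schwarz[OF t d(1)]
        mult_right_mono[OF l2_norm_trunc_le[OF u] l2_norm_nonneg[OF d(1)], of T] by linarith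
    moreover note l2_Cauchy_Schwarz[OF d(2) Fu]
    ultimately show ?thesis by simp
  qed
  have lim: "(\<lambda>T. l2_norm (\<lambda>k. \<psi> (trunc T u) k - F u k)) \<longlonglongrightarrow> 0"
    using l2_continuous_trunc[OF F(2) u F(1)] F(3)[OF trunc_ellf] by simp
  have "(\<lambda>T. l2_norm u * l2_norm (\<lambda>k. \<psi> (trunc T u) k - F u k) +
        l2_norm (\<lambda>k. trunc T u k - u k) * l2_norm (F u)) \<longlonglongrightarrow> 0"
    using tendsto_add[OF tendsto_mult_right_zero[OF lim] tendsto_mult_left_zero[OF trunc_tendsto[OF u]]]
    by simp
  then show ?thesis
    unfolding F_def[symmetric]
    by (rule LIM_zero_cancel[OF Lim_null_comparison[rotated]]) (use bound in simp)
qed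

section \<open>Stacked signals and exponential weights\<close>

lemma power2_norm_stack: "(norm (stack y w k))\<^sup>2 = (norm (y k))\<^sup>2 + (norm (w k))\<^sup>2"
  unfolding power2_norm_eq_inner inner_vec_def stack_def
  by (subst UNIV_Plus_UNIV[symmetric], subst sum.Plus) simp_all

lemma stack_ell2: "y \<in> ell2 \<Longrightarrow> w \<in> ell2 \<Longrightarrow> stack y w \<in> ell2"
  by (simp add: ell2_def power2_norm_stack summable_add)

lemma rho_plus_stack: "rho_plus \<rho> (stack y w) = stack (rho_plus \<rho> y) (rho_plus \<rho> w)"
  by (auto simp: rho_plus_def stack_def fun_eq_iff vec_eq_iff split: sum.splits)

lemma rho_plus_ellf: "u \<in> ellf \<Longrightarrow> rho_plus \<rho> u \<in> ellf"
  unfolding ellf_def rho_plus_def mem_Collect_eq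
  by (erule rev_finite_subset) auto

lemma linear_on_ellf_rho:
  assumes "linear_on_ellf \<phi>"
  shows "linear_on_ellf (rho_plus \<rho> \<circ> \<phi> \<circ> rho_plus \<rho>)"
proof -
  have "rho_plus \<rho> (\<lambda>k. u k + v k) = (\<lambda>k. rho_plus \<rho> u k + rho_plus \<rho> v k)"
    "rho_plus \<rho> (\<lambda>k. c *\<^sub>R u k) = (\<lambda>k. c *\<^sub>R rho_plus \<rho> u k)"
    for c and u v :: "'a signal"
    by (auto simp: rho_plus_def scaleR_add_right)
  then show ?thesis
    using assms by (simp add: linear_on_ellf_def rho_plus_ellf)
qed

text \<open>\<open>rho_plus\<close> acts diagonally, so the weight \<open>\<rho> ^ k\<close> moves
  across the inner product in each term. All terms beyond \<open>T\<close> vanish on both sides, so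
  both series are finite sums although \<open>\<phi>\<close> may have values outside
  \<open>ell2\<close>.\<close>

lemma l2_inner_trunc_rho_plus:
  "l2_inner (trunc T u) ((rho_plus \<rho> \<circ> \<phi> \<circ> rho_plus \<rho>) (trunc T u)) =
    l2_inner (rho_plus \<rho> u) (trunc T (\<phi> (trunc T (rho_plus \<rho> u))))"
proof -
  have "rho_plus \<rho> (trunc T u) = trunc T (rho_plus \<rho> u)"
    by (auto simp: rho_plus_def trunc_def)
  then show ?thesis
    unfolding l2_inner_def comp_apply
    by (intro suminf_cong) (simp add: rho_plus_def trunc_def)
qed

theorem lemma2:
  fixes \<rho> :: real
    and D :: "(('p::finite) signal \<Rightarrow> 'p signal) set"
    and \<phi> :: "('p + 'p) signal \<Rightarrow> ('p + 'p) signal"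
  assumes "0 < \<rho>" and "\<rho> < 1"
    and "D \<subseteq> {\<Delta> \<in> bounded_operators. \<Delta> ` ell2_rho \<rho> \<subseteq> ell2_rho \<rho>}"
    and "linear_on_ellf \<phi>"
    and "l2_bounded_on ellf (rho_plus \<rho> \<circ> \<phi> \<circ> rho_plus \<rho>)"
    and "\<forall>y\<in>ell2. \<forall>\<Delta>\<in>D. \<forall>T.
           l2_inner (stack y (\<Delta> y)) (trunc T (\<phi> (trunc T (stack y (\<Delta> y))))) \<ge> 0"
  shows "\<forall>y\<in>ell2. \<forall>\<Delta>\<in>D. \<forall>\<Delta>\<^sub>\<rho>. \<Delta>\<^sub>\<rho> = rho_minus \<rho> \<circ> \<Delta> \<circ> rho_plus \<rho> \<longrightarrow>
           l2_inner (stack y (\<Delta>\<^sub>\<rho> y))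
             (l2_extension (rho_plus \<rho> \<circ> \<phi> \<circ> rho_plus \<rho>) (stack y (\<Delta>\<^sub>\<rho> y))) \<ge> 0"
proof (intro ballI allI impI)
  fix y :: "'p signal" and \<Delta> \<Delta>\<^sub>\<rho>
  assume y: "y \<in> ell2" and \<Delta>: "\<Delta> \<in> D"
    and \<Delta>\<^sub>\<rho>: "\<Delta>\<^sub>\<rho> = rho_minus \<rho> \<circ> \<Delta> \<circ> rho_plus \<rho>"
  define z where "z = stack y (\<Delta>\<^sub>\<rho> y)"
  have minus_plus: "rho_minus \<rho> (rho_plus \<rho> u) = u" "rho_plus \<rho> (rho_minus \<rho> u) = u"
    for u :: "'p signal"
    using assms(1) by (auto simp: rho_minus_def rho_plus_def)
  \<comment> \<open>The invariance of \<open>ell2_rho\<close> under \<open>\<Delta>\<close> is what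
    keeps \<open>\<Delta>\<^sub>\<rho> y\<close> in \<open>ell2\<close>: \<open>rho_minus\<close>
    may amplify a general element of \<open>ell2\<close> beyond square-summability.\<close>
  have "rho_plus \<rho> y \<in> ell2_rho \<rho>"
    using y by (simp add: ell2_rho_def minus_plus)
  then have "\<Delta> (rho_plus \<rho> y) \<in> ell2_rho \<rho>" using assms(3) \<Delta> by blast
  then have "\<Delta>\<^sub>\<rho> y \<in> ell2" by (simp add: \<Delta>\<^sub>\<rho> ell2_rho_def)
  with y have z: "z \<in> ell2" unfolding z_def by (rule stack_ell2)
  have plus_z: "rho_plus \<rho> z = stack (rho_plus \<rho> y) (\<Delta> (rho_plus \<rho> y))"
    by (simp add: z_def rho_plus_stack \<Delta>\<^sub>\<rho> minus_plus)
  \<comment> \<open>The hypothesis speaks about signals in \<open>ell2\<close>, so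
    \<open>rho_plus \<rho> y\<close> must be one; the weights \<open>\<rho> ^ k\<close> are at most
    1.\<close>
  have "rho_plus \<rho> y \<in> ell2"
    using y
  proof (rule ell2_norm_mono)
    show "norm (rho_plus \<rho> y k) \<le> norm (y k)" for k
      using assms(1,2) by (simp add: rho_plus_def mult_left_le_one_le power_le_one)
  qed
  then have "0 \<le> l2_inner (trunc T z) ((rho_plus \<rho> \<circ> \<phi> \<circ> rho_plus \<rho>) (trunc T z))" for T
    using assms(6) \<Delta> unfolding l2_inner_trunc_rho_plus plus_z by blast
  then show "0 \<le> l2_inner (stack y (\<Delta>\<^sub>\<rho> y))
      (l2_extension (rho_plus \<rho> \<circ> \<phi> \<circ> rho_plus \<rho>) (stack y (\<Delta>\<^sub>\<rho> y)))"
    using l2_quadratic_form_tendsto[OF linear_on_ellf_rho[OF assms(4)] assms(5) z]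
    unfolding z_def[symmetric] by (intro LIMSEQ_le_const) auto
qed

end
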